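(* Let $\ell:\Delta^C\times\mathcal{Y}\to\mathbb{R}$ be a continuous strictly proper loss, let $T\in\mathbb{R}^{C\times C}$ be an invertible column-stochastic matrix, and let $L$ be the $0$-$1$ loss. Then there exists a strictly increasing and continuous function $\theta:[0,1]\to[0,\infty]$, depending only on $\ell$ and $T$, with $\theta(0)=0$, such that for every probability measure $P$ on $\mathcal{X}\times\mathcal{Y}$ with $\mathcal{R}^*_{\ell_T,P_T}<\infty$ and every $f\in\mathcal{F}$, $$\mathcal{R}_{L,P}(f)-\mathcal{R}^*_{L,P}\;\le\;\theta^{-1}\left(\mathcal{R}_{\ell_T,P_T}(f)-\mathcal{R}^*_{\ell_T,P_T}\right),$$ where this inequality is understood as $\theta\left(\mathcal{R}_{L,P}(f)-\mathcal{R}^*_{L,P}\right)\le \mathcal{R}_{\ell_T,P_T}(f)-\mathcal{R}^*_{\ell_T,P_T}$.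
   Context: $\mathcal{X}$ is a (measurable) feature space, $\mathcal{Y}=\{1,\dots,C\}$, $\Delta^C=\{p\in\mathbb{R}^C: p_i\ge 0\ \forall i,\ \sum_i p_i=1\}$. $\mathcal{F}$ is the set of all measurable functions $\mathcal{X}\to\Delta^C$. For a probability measure $P$ on $\mathcal{X}\times\mathcal{Y}$ (law of $(X,Y)$), a regular conditional distribution $P(\cdot\mid x)$ of $Y$ given $X=x$ is assumed to exist and is fixed; $\eta(x)=(P(1\mid x),\dots,P(C\mid x))^{tr}\in\Delta^C$. Noisy distribution: for a column-stochastic $T=(t_{i,j})$, $P_T$ is the law of $(X,\tilde Y)$ on $\mathcal{X}\times\mathcal{Y}$, where $(X,Y,\tilde Y)$ has law $\bar P_T$ with $\bar P_T(\mathcal{A}\times\{i\}\times\{j\})=P(\mathcal{A}\times\{i\})\,t_{j,i}$; the conditional distribution of $\tilde Y$ given $X=x$ under $P_T$ is the probability vector $T\eta(x)$. For a loss $L:\Delta^C\times\mathcal{Y}\to\mathbb{R}$: inner risk $\mathcal{C}_{L,P,x}(q)=\mathbb{E}_{Y\sim P(\cdot\mid x)}L(q,Y)$ for $q\in\Delta^C$, minimal inner risk $\mathcal{C}^*_{L,P,x}=\inf_{q\in\Delta^C}\mathcal{C}_{L,P,x}(q)$; risk $\mathcal{R}_{L,P}(f)=\mathbb{E}_P[L(f(X),Y)]$ and Bayes risk $\mathcal{R}^*_{L,P}=\inf_{f\in\mathcal{F}}\mathcal{R}_{L,P}(f)$. A loss $\ell$ is proper if $\mathcal{C}^*_{\ell,P,x}=\mathcal{C}_{\ell,P,x}(\eta(x))$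 for all probability measures $P$ on $\mathcal{X}\times\mathcal{Y}$ and all $x\in\mathcal{X}$ (i.e. $q\mapsto\sum_c p_c\ell(q,c)$ is minimized over $\Delta^C$ at $q=p$, for every $p\in\Delta^C$); it is strictly proper if in addition this minimizer is always unique. It is continuous if $\ell(\cdot,c)$ is continuous on $\Delta^C$ for each $c$. The $0$-$1$ loss is $L(q,c)=\mathbf{1}_{c\neq\min\{\arg\max_j q_j\}}$. The forward correction loss of $\ell$ is $\ell_T(q,c)=\ell(Tq,c)$. *)

theory Defs
  imports "HOL-Probability.Probability"
begin

(* The label set {1,...,C} is a finite linearly ordered type 'c with C = CARD('c).  A loss is a
   function on all of real^'c, but only its values on the probability simplex are ever used. *)

type_synonym 'c loss = "real ^ 'c \<Rightarrow> 'c \<Rightarrow> real"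

definition prob_simplex :: "(real ^ 'c::finite) set" where
  "prob_simplex = {p. (\<forall>i. 0 \<le> p $ i) \<and> (\<Sum>i\<in>UNIV. p $ i) = 1}"

definition column_stochastic :: "real ^ 'c ^ 'c::finite \<Rightarrow> bool" where
  "column_stochastic T \<longleftrightarrow> (\<forall>i j. 0 \<le> T $ i $ j) \<and> (\<forall>j. (\<Sum>i\<in>UNIV. T $ i $ j) = 1)"


(* Here p is the conditional distribution of the label at a point x of the feature space; the
   inner risk depends on the joint distribution and on x only through p, and every p in the simplex
   occurs as such a conditional distribution. *)

definition inner_risk :: "'c::finite loss \<Rightarrow> real ^ 'c \<Rightarrow> real ^ 'c \<Rightarrow> real" where
  "inner_risk l p q = (\<Sum>c\<in>UNIV. p $ c * l q c)"

definition min_inner_risk :: "'c::finite loss \<Rightarrow> real ^ 'c \<Rightarrow> ereal" where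
  "min_inner_risk l p = (INF q\<in>prob_simplex. ereal (inner_risk l p q))"

definition proper_loss :: "'c::finite loss \<Rightarrow> bool" where
  "proper_loss l \<longleftrightarrow> (\<forall>p\<in>prob_simplex. min_inner_risk l p = ereal (inner_risk l p p))"

definition strictly_proper_loss :: "'c::finite loss \<Rightarrow> bool" where
  "strictly_proper_loss l \<longleftrightarrow> proper_loss l \<and>
     (\<forall>p\<in>prob_simplex. \<forall>q\<in>prob_simplex.
        ereal (inner_risk l p q) = min_inner_risk l p \<longrightarrow> q = p)"

definition continuous_loss :: "'c::finite loss \<Rightarrow> bool" where
  "continuous_loss l \<longleftrightarrow> (\<forall>c. continuous_on prob_simplex (\<lambda>q. l q c))"

definition zero_one_loss :: "'c::{finite,linorder} loss" where
  "zero_one_loss q c = (if c \<noteq> Min {j. \<forall>k. q $ k \<le> q $ j} then 1 else 0)"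

definition forward_loss :: "real ^ 'c ^ 'c \<Rightarrow> 'c::finite loss \<Rightarrow> 'c loss" where
  "forward_loss T l q c = l (T *v q) c"


definition joint_distribution :: "'x measure \<Rightarrow> ('x \<times> 'c::finite) measure \<Rightarrow> bool" where
  "joint_distribution M P \<longleftrightarrow> prob_space P \<and> sets P = sets (M \<Otimes>\<^sub>M count_space UNIV)"

definition predictors :: "'x measure \<Rightarrow> ('x \<Rightarrow> real ^ 'c::finite) set" where
  "predictors M = M \<rightarrow>\<^sub>M restrict_space borel prob_simplex"

(* Expectation of positive part minus expectation of negative part, so that infinite risks are
   not identified with 0 as they would be by the Bochner integral.  If both parts are infinite,
   the value is \<infinity>. *)

definition ext_expectation :: "'a measure \<Rightarrow> ('a \<Rightarrow> real) \<Rightarrow> ereal" where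
  "ext_expectation P g =
     enn2ereal (\<integral>\<^sup>+ z. ennreal (g z) \<partial>P) - enn2ereal (\<integral>\<^sup>+ z. ennreal (- g z) \<partial>P)"

definition risk :: "'c::finite loss \<Rightarrow> ('x \<times> 'c) measure \<Rightarrow> ('x \<Rightarrow> real ^ 'c) \<Rightarrow> ereal" where
  "risk L P f = ext_expectation P (\<lambda>(x, y). L (f x) y)"

definition bayes_risk :: "'x measure \<Rightarrow> 'c::finite loss \<Rightarrow> ('x \<times> 'c) measure \<Rightarrow> ereal" where
  "bayes_risk M L P = (INF f\<in>predictors M. risk L P f)"


(* The law of ((X, Y), noisy Y); emeasure_noisy_joint below is its characterization on boxes. *)

definition noisy_joint ::
    "real ^ 'c ^ 'c \<Rightarrow> ('x \<times> 'c::finite) measure \<Rightarrow> (('x \<times> 'c) \<times> 'c) measure" where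
  "noisy_joint T P =
     density (P \<Otimes>\<^sub>M count_space UNIV) (\<lambda>((x, i), j). ennreal (T $ j $ i))"

definition noisy_distribution ::
    "real ^ 'c ^ 'c \<Rightarrow> ('x \<times> 'c::finite) measure \<Rightarrow> ('x \<times> 'c) measure" where
  "noisy_distribution T P = distr (noisy_joint T P) P (\<lambda>((x, i), j). (x, j))"

lemma emeasure_noisy_joint:
  fixes T :: "real ^ 'c ^ 'c::finite" and P :: "('x \<times> 'c) measure"
  assumes P: "joint_distribution M P" and A: "A \<in> sets M"
  shows "emeasure (noisy_joint T P) ((A \<times> {i}) \<times> {j}) =
         emeasure P (A \<times> {i}) * ennreal (T $ j $ i)"
proof -
  interpret prob_space P using P by (simp add: joint_distribution_def)
  have sets_P [measurable_cong]: "sets P = sets (M \<Otimes>\<^sub>M count_space UNIV)"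
    using P by (simp add: joint_distribution_def)
  interpret C: sigma_finite_measure "count_space (UNIV :: 'c set)"
    by (simp add: sigma_finite_measure_count_space_finite)
  have Ai: "A \<times> {i} \<in> sets P"
    using A by (simp add: sets_P)
  have box: "(A \<times> {i}) \<times> {j} \<in> sets (P \<Otimes>\<^sub>M count_space UNIV)"
    using Ai by simp
  have *: "(\<lambda>z. ennreal (T $ snd z $ snd (fst z))) \<in>
      borel_measurable (P \<Otimes>\<^sub>M count_space (UNIV :: 'c set))"
  proof -
    have "(\<lambda>z. (snd z, snd (fst z))) \<in>
        P \<Otimes>\<^sub>M count_space (UNIV :: 'c set) \<rightarrow>\<^sub>M count_space UNIV \<Otimes>\<^sub>M count_space UNIV"
      by measurable
    moreover have "count_space (UNIV :: 'c set) \<Otimes>\<^sub>M count_space (UNIV :: 'c set) = count_space UNIV"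
      by (simp add: pair_measure_count_space)
    ultimately have "(\<lambda>z. (snd z, snd (fst z))) \<in>
        P \<Otimes>\<^sub>M count_space (UNIV :: 'c set) \<rightarrow>\<^sub>M count_space (UNIV :: ('c \<times> 'c) set)"
      by simp
    then have "(\<lambda>z. (\<lambda>(j, i). ennreal (T $ j $ i)) (snd z, snd (fst z))) \<in>
      borel_measurable (P \<Otimes>\<^sub>M count_space (UNIV :: 'c set))"
      by (rule measurable_compose) simp
    then show ?thesis by simp
  qed
  have "emeasure (noisy_joint T P) ((A \<times> {i}) \<times> {j}) =
    (\<integral>\<^sup>+ z. ennreal (T $ snd z $ snd (fst z)) * indicator ((A \<times> {i}) \<times> {j}) z
      \<partial>(P \<Otimes>\<^sub>M count_space UNIV))"
    unfolding noisy_joint_def case_prod_beta' using * box by (rule emeasure_density)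
  also have "\<dots> = (\<integral>\<^sup>+ z. ennreal (T $ j $ i) * indicator ((A \<times> {i}) \<times> {j}) z
      \<partial>(P \<Otimes>\<^sub>M count_space UNIV))"
    by (intro nn_integral_cong) (auto simp: indicator_def)
  also have "\<dots> = ennreal (T $ j $ i) * emeasure (P \<Otimes>\<^sub>M count_space UNIV) ((A \<times> {i}) \<times> {j})"
    using box by (rule nn_integral_cmult_indicator)
  also have "\<dots> = emeasure P (A \<times> {i}) * ennreal (T $ j $ i)"
    using Ai by (simp add: C.emeasure_pair_measure_Times mult.commute)
  finally show ?thesis .
qed

end

theory Submission imports Defs begin

text \<open>
  Write \<open>D p q\<close> for the regret of \<open>l\<close> between \<open>T p\<close> and \<open>T q\<close>.  By compactness, continuity and
  injectivity of \<open>T\<close>, \<open>D p q \<ge> m(\<epsilon>) > 0\<close> whenever \<open>norm (p - q) \<ge> \<epsilon>/2\<close>, while the pointwise excess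
  0-1 risk over any competitor, \<open>\<delta> = p\<^sub>k - p\<^sub>h\<close> with \<open>h\<close> the label chosen by \<open>q\<close>, is at most
  \<open>min 1 (2 norm (p - q))\<close>.  Hence \<open>D p q \<ge> m(\<epsilon>) (\<delta> - \<epsilon>)\<close>.  Being affine in \<open>\<delta>\<close>, this bound
  integrates over the feature space, so that neither Jensen's inequality nor convexity of a
  calibration function enters, and \<open>\<theta>(r) = sup\<^sub>\<epsilon> m(\<epsilon>) max 0 (r - \<epsilon>)\<close> works.  The minimal risks are
  never computed: the noisy Bayes risk is at most the risk of the true conditional distribution
  \<open>\<eta>\<close>, and the clean one is handled by comparing with every competitor.
\<close>

section \<open>Simplex-valued predictors and measurability with finitely many labels\<close>

lemma space_joint: "joint_distribution M P \<Longrightarrow> space P = space M \<times> UNIV"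
  unfolding joint_distribution_def by (metis sets_eq_imp_space_eq space_count_space space_pair_measure)

lemma predictor_in_simplex: "f \<in> predictors M \<Longrightarrow> x \<in> space M \<Longrightarrow> f x \<in> prob_simplex"
  unfolding predictors_def by (auto dest!: measurable_space simp: space_restrict_space)

lemma prob_simplex_component_le_1: "p \<in> prob_simplex \<Longrightarrow> p $ i \<le> 1"
  unfolding prob_simplex_def using member_le_sum[of i UNIV "\<lambda>i. p $ i"] by auto

lemma prob_simplex_nonneg: "p \<in> prob_simplex \<Longrightarrow> 0 \<le> p $ i"
  unfolding prob_simplex_def by auto

lemma axis_in_prob_simplex: "axis i 1 \<in> prob_simplex"
  unfolding prob_simplex_def by (auto simp: axis_def)

lemma predictorI:
  assumes "\<And>i. (\<lambda>x. f x $ i) \<in> borel_measurable M"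
    and "\<And>x. x \<in> space M \<Longrightarrow> f x \<in> prob_simplex"
  shows "f \<in> predictors M"
proof -
  have "f \<in> borel_measurable M"
    by (subst borel_measurable_euclidean_space) (auto simp: Basis_vec_def inner_axis assms(1))
  then show ?thesis
    unfolding predictors_def using assms(2) by (intro measurable_restrict_space2) auto
qed

lemma predictor_borel: "f \<in> predictors M \<Longrightarrow> f \<in> borel_measurable M"
  unfolding predictors_def by (simp add: measurable_restrict_space2_iff)

lemma predictor_component_measurable:
  assumes "f \<in> predictors M" shows "(\<lambda>x. f x $ i) \<in> borel_measurable M"
proof -
  have "(\<lambda>v::real^'b. v $ i) \<in> borel_measurable borel"
    by (intro borel_measurable_continuous_onI continuous_intros)
  from measurable_compose[OF predictor_borel[OF assms] this] show ?thesis .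
qed

text \<open>The label takes finitely many values, and on each slice \<open>snd = c\<close> the map
  is a measurable function of the first coordinate alone. Joint measurability is thereby reduced to
  sections.\<close>

lemma measurable_pair_finite_label:
  assumes "\<And>c::'c::finite. (\<lambda>x. h x c) \<in> N \<rightarrow>\<^sub>M K"
  shows "(\<lambda>(x, c). h x c) \<in> N \<Otimes>\<^sub>M count_space UNIV \<rightarrow>\<^sub>M K"
proof -
  have "(\<lambda>z. h (fst z) (snd z)) \<in> N \<Otimes>\<^sub>M count_space UNIV \<rightarrow>\<^sub>M K"
    using assms
    by (intro measurable_compose_countable'[where f="\<lambda>c z. h (fst z) c" and g=snd and I=UNIV]
        measurable_compose[OF measurable_fst]) (auto simp: countable_finite)
  then show ?thesis by (simp add: case_prod_beta')
qed

section \<open>Existence of the conditional label distribution\<close>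

text \<open>Radon-Nikodym is applied label by label: \<open>P (A \<times> {c})\<close>, as a measure
  in \<open>A\<close>, is dominated by the marginal \<mu>, and its density at \<open>x\<close> is
  the conditional probability of \<open>c\<close>. The result is stated as a density of
  \<open>P\<close> over a product measure, the form in which Fubini applies.\<close>

lemma joint_disintegration:
  fixes P :: "('x \<times> 'c::finite) measure"
  assumes P: "joint_distribution M P"
  obtains \<mu> \<eta> where "prob_space \<mu>" "sets \<mu> = sets M" "\<eta> \<in> predictors M"
    "P = density (\<mu> \<Otimes>\<^sub>M count_space UNIV) (\<lambda>(x, c). ennreal (\<eta> x $ c))"
proof -
  interpret P: prob_space P using P by (simp add: joint_distribution_def)
  have sP [measurable_cong]: "sets P = sets (M \<Otimes>\<^sub>M count_space UNIV)"
    using P by (simp add: joint_distribution_def)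
  have fst_m: "fst \<in> P \<rightarrow>\<^sub>M M" by measurable
  define \<mu> where "\<mu> = distr P M fst"
  have s\<mu> [measurable_cong]: "sets \<mu> = sets M" by (simp add: \<mu>_def)
  have sPN: "sets P = sets (\<mu> \<Otimes>\<^sub>M count_space UNIV)"
    unfolding sP using s\<mu> by (intro sets_pair_measure_cong) simp_all
  interpret \<mu>: prob_space \<mu> unfolding \<mu>_def by (rule P.prob_space_distr[OF fst_m])
  \<comment> \<open>The unnormalised law of the feature on the event that the label is
    \<open>c\<close>: \<open>P\<close> is restricted to a slice and pushed forward.\<close>
  define \<nu> where "\<nu> c = distr (density P (indicator (space M \<times> {c}))) M fst" for c
  have slice: "space M \<times> {c} \<in> sets P" for c by (simp add: sP)
  have prj: "fst -` A \<inter> space P = A \<times> UNIV" if "A \<in> sets M" for A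
    using sets.sets_into_space[OF that] by (auto simp: space_joint[OF P])
  have \<nu>: "emeasure (\<nu> c) A = emeasure P (A \<times> {c})" if A: "A \<in> sets M" for A c
  proof -
    have AU: "A \<times> UNIV \<in> sets P" using A by (simp add: sP)
    have "emeasure (\<nu> c) A = emeasure (density P (indicator (space M \<times> {c}))) (A \<times> UNIV)"
      unfolding \<nu>_def using A fst_m prj[OF A] by (subst emeasure_distr) auto
    also have "\<dots> = emeasure P ((space M \<times> {c}) \<inter> (A \<times> UNIV))"
      using emeasure_restricted[OF slice AU] .
    also have "(space M \<times> {c}) \<inter> (A \<times> UNIV) = A \<times> {c}"
      using sets.sets_into_space[OF A] by auto
    finally show ?thesis .
  qed
  have \<mu>: "emeasure \<mu> A = emeasure P (A \<times> UNIV)" if A: "A \<in> sets M" for A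
    unfolding \<mu>_def using A fst_m prj[OF A] by (subst emeasure_distr) auto
  have "\<exists>g. g \<in> borel_measurable \<mu> \<and> density \<mu> g = \<nu> c" for c
  proof -
    have "finite_measure (\<nu> c)"
      by (rule finite_measureI) (simp add: \<nu>[OF sets.top] \<nu>_def, simp flip: \<nu>_def add: \<nu>)
    moreover have "absolutely_continuous \<mu> (\<nu> c)"
      unfolding absolutely_continuous_def
    proof (rule subsetI)
      fix A assume "A \<in> null_sets \<mu>"
      then have A: "A \<in> sets M" and 0: "emeasure P (A \<times> UNIV) = 0"
        using \<mu> by (auto simp: null_sets_def s\<mu>)
      have "emeasure P (A \<times> {c}) \<le> emeasure P (A \<times> UNIV)"
        using A by (intro emeasure_mono) (auto simp: sP)
      then show "A \<in> null_sets (\<nu> c)" using A 0 \<nu>[OF A] by (auto simp: null_sets_def \<nu>_def)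
    qed
    moreover have "sets (\<nu> c) = sets \<mu>" by (simp add: \<nu>_def s\<mu>)
    ultimately show ?thesis using \<mu>.Radon_Nikodym_finite_measure by blast
  qed
  then obtain g where g [measurable]: "\<And>c. g c \<in> borel_measurable \<mu>"
    and g\<nu>: "\<And>c. density \<mu> (g c) = \<nu> c" by metis
  have gM [measurable]: "g c \<in> borel_measurable M" for c
    using g[of c] by (simp cong: measurable_cong_sets add: s\<mu>)
  \<comment> \<open>The measures \<open>\<nu> c\<close> add up to \<mu>, so the sum of their
    densities and the constant 1 are both densities of \<mu> with respect to itself. Uniqueness of
    densities gives equality almost everywhere.\<close>
  have sum1: "AE x in \<mu>. (\<Sum>c\<in>UNIV. g c x) = 1"
  proof -
    have "density \<mu> (\<lambda>x. \<Sum>c\<in>UNIV. g c x) = density \<mu> (\<lambda>_. 1)"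
    proof (rule measure_eqI)
      fix A assume "A \<in> sets (density \<mu> (\<lambda>x. \<Sum>c\<in>UNIV. g c x))"
      then have A: "A \<in> sets M" by (simp add: s\<mu>)
      have "emeasure (density \<mu> (\<lambda>x. \<Sum>c\<in>UNIV. g c x)) A = (\<Sum>c\<in>UNIV. emeasure (density \<mu> (g c)) A)"
        using A by (simp add: emeasure_density s\<mu> nn_integral_sum[symmetric])
          (auto intro!: nn_integral_cong simp: indicator_def)
      also have "\<dots> = (\<Sum>c\<in>UNIV. emeasure P (A \<times> {c}))" using A by (simp add: g\<nu> \<nu>)
      also have "\<dots> = emeasure P (\<Union>c. A \<times> {c})"
        using A by (intro sum_emeasure) (auto simp: sP disjoint_family_on_def)
      also have "(\<Union>c. A \<times> {c}) = A \<times> UNIV" by auto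
      also have "emeasure P (A \<times> UNIV) = emeasure (density \<mu> (\<lambda>_. 1)) A"
        using A by (simp add: \<mu> density_1)
      finally show "emeasure (density \<mu> (\<lambda>x. \<Sum>c\<in>UNIV. g c x)) A = emeasure (density \<mu> (\<lambda>_. 1)) A" .
    qed simp
    then show ?thesis by (subst (asm) \<mu>.density_unique_iff) auto
  qed
  \<comment> \<open>Membership in \<open>predictors\<close> is demanded at every point, not almost
    everywhere. On the null set where the densities fail to sum to 1, a vertex of the simplex at an
    arbitrary label is used instead.\<close>
  define \<eta> :: "'x \<Rightarrow> real ^ 'c" where
    "\<eta> x = (if (\<Sum>c\<in>UNIV. g c x) = 1 then \<chi> c. enn2real (g c x) else axis undefined 1)" for x
  have \<eta>: "\<eta> \<in> predictors M"
  proof (rule predictorI)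
    show "(\<lambda>x. \<eta> x $ i) \<in> borel_measurable M" for i
      unfolding \<eta>_def if_distrib[of "\<lambda>v. v $ i"] vec_lambda_beta by measurable
    show "\<eta> x \<in> prob_simplex" for x
    proof (cases "(\<Sum>c\<in>UNIV. g c x) = 1")
      case True
      have "g c x < \<top>" for c
        using member_le_sum[of c UNIV "\<lambda>c. g c x"] True
        by (auto simp: less_top intro: le_less_trans)
      then have "ennreal (\<Sum>c\<in>UNIV. enn2real (g c x)) = ennreal 1"
        using True by (subst sum_ennreal[symmetric]) auto
      then have "(\<Sum>c\<in>UNIV. enn2real (g c x)) = 1"
        by (subst (asm) ennreal_inj) (auto intro: sum_nonneg)
      then show ?thesis using True by (auto simp: \<eta>_def prob_simplex_def)
    qed (auto simp: \<eta>_def axis_in_prob_simplex)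
  qed
  have \<eta>g: "AE x in \<mu>. \<forall>c. ennreal (\<eta> x $ c) = g c x"
    using sum1
  proof eventually_elim
    case (elim x)
    have "g c x < \<top>" for c
      using member_le_sum[of c UNIV "\<lambda>c. g c x"] elim
      by (auto simp: less_top intro: le_less_trans)
    then show ?case using elim by (simp add: \<eta>_def)
  qed
  have \<eta>_m [measurable]: "(\<lambda>x. \<eta> x $ c) \<in> borel_measurable M" for c
    by (rule predictor_component_measurable[OF \<eta>])
  have \<eta>_joint: "(\<lambda>(x, c). ennreal (\<eta> x $ c)) \<in> borel_measurable (\<mu> \<Otimes>\<^sub>M count_space UNIV)"
    by (rule measurable_pair_finite_label) simp_all
  interpret C: sigma_finite_measure "count_space (UNIV :: 'c set)"
    by (simp add: sigma_finite_measure_count_space_finite)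
  have "P = density (\<mu> \<Otimes>\<^sub>M count_space UNIV) (\<lambda>(x, c). ennreal (\<eta> x $ c))" (is "_ = ?Q")
  proof (rule measure_eqI)
    show "sets P = sets ?Q" by (simp add: sPN)
    fix B assume B: "B \<in> sets P"
    \<comment> \<open>Every measurable set is a finite disjoint union of rectangles
      \<open>A c \<times> {c}\<close>, on which both measures are given by the densities
      \<open>g c\<close>.\<close>
    define A where "A c = (\<lambda>x. (x, c)) -` B \<inter> space M" for c
    have A: "A c \<in> sets M" for c
      unfolding A_def using B by (intro measurable_sets[where A="M \<Otimes>\<^sub>M count_space UNIV"]) (auto simp: sP)
    have BA: "B = (\<Union>c. A c \<times> {c})"
      using sets.sets_into_space[OF B] by (auto simp: A_def space_joint[OF P])
    have BQ: "B \<in> sets (\<mu> \<Otimes>\<^sub>M count_space UNIV)" using B by (simp add: sPN)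
    have "emeasure P B = (\<Sum>c\<in>UNIV. emeasure P (A c \<times> {c}))"
      unfolding BA using A by (intro sum_emeasure[symmetric]) (auto simp: sP disjoint_family_on_def)
    also have "\<dots> = (\<Sum>c\<in>UNIV. \<integral>\<^sup>+x. g c x * indicator (A c) x \<partial>\<mu>)"
      using A by (simp add: \<nu>[symmetric] g\<nu>[symmetric] emeasure_density s\<mu>)
    also have "\<dots> = (\<integral>\<^sup>+x. (\<Sum>c\<in>UNIV. g c x * indicator (A c) x) \<partial>\<mu>)"
      using A by (subst nn_integral_sum) (auto simp: s\<mu>)
    also have "\<dots> = (\<integral>\<^sup>+x. (\<Sum>c\<in>UNIV. ennreal (\<eta> x $ c) * indicator B (x, c)) \<partial>\<mu>)"
      using \<eta>g by (intro nn_integral_cong_AE, eventually_elim)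
        (auto simp: A_def indicator_def space_joint[OF P] intro!: sum.cong dest: sets.sets_into_space[OF B, THEN subsetD])
    also have "\<dots> = (\<integral>\<^sup>+x. \<integral>\<^sup>+c. ennreal (\<eta> x $ c) * indicator B (x, c) \<partial>count_space UNIV \<partial>\<mu>)"
      by (simp add: nn_integral_count_space_finite)
    also have "\<dots> = (\<integral>\<^sup>+z. (case z of (x, c) \<Rightarrow> ennreal (\<eta> x $ c)) * indicator B z \<partial>(\<mu> \<Otimes>\<^sub>M count_space UNIV))"
      using \<eta>_joint BQ by (subst C.nn_integral_fst[symmetric]) auto
    also have "\<dots> = emeasure ?Q B"
      using \<eta>_joint BQ by (simp add: emeasure_density)
    finally show "emeasure P B = emeasure ?Q B" .
  qed
  then show thesis using that \<eta> s\<mu> \<mu>.prob_space_axioms by blast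
qed

section \<open>Risks as integrals of inner risks\<close>

lemma ext_expectation_integrable:
  assumes "integrable P g"
  shows "ext_expectation P g = ereal (integral\<^sup>L P g)"
proof -
  have "(\<integral>\<^sup>+ z. ennreal (g z) \<partial>P) < \<infinity>" "(\<integral>\<^sup>+ z. ennreal (- g z) \<partial>P) < \<infinity>"
    using assms by (auto simp: real_integrable_def top.not_eq_extremum)
  then show ?thesis
    unfolding ext_expectation_def real_lebesgue_integral_def[OF assms]
    by (cases "\<integral>\<^sup>+ z. ennreal (g z) \<partial>P"; cases "\<integral>\<^sup>+ z. ennreal (- g z) \<partial>P") auto
qed

text \<open>A class containing both the discontinuous 0-1 loss and the continuous forward loss, and
  closed under averaging over the noise. Its members have integrable loss along any predictor under
  any joint law, so extended expectations become ordinary integrals.\<close>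

definition bounded_measurable_loss :: "'c::finite loss \<Rightarrow> bool" where
  "bounded_measurable_loss L \<longleftrightarrow>
     (\<forall>c. (\<lambda>q. L q c) \<in> borel_measurable (restrict_space borel prob_simplex)) \<and>
     (\<exists>B. \<forall>q\<in>prob_simplex. \<forall>c. \<bar>L q c\<bar> \<le> B)"

lemma bounded_loss_along_predictor:
  fixes L :: "'c::finite loss"
  assumes "bounded_measurable_loss L" "f \<in> predictors M"
  shows "(\<lambda>(x, c). L (f x) c) \<in> borel_measurable (M \<Otimes>\<^sub>M count_space UNIV)"
    and "\<exists>B. \<forall>x\<in>space M. \<forall>c. \<bar>L (f x) c\<bar> \<le> B"
proof -
  have fm: "f \<in> M \<rightarrow>\<^sub>M restrict_space borel prob_simplex"
    using assms(2) by (simp add: predictors_def)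
  have Lm: "(\<lambda>q. L q c) \<in> borel_measurable (restrict_space borel prob_simplex)" for c
    using assms(1) by (simp add: bounded_measurable_loss_def)
  have "(\<lambda>x. L (f x) c) \<in> borel_measurable M" for c
    by (rule measurable_compose[OF fm Lm])
  then show "(\<lambda>(x, c). L (f x) c) \<in> borel_measurable (M \<Otimes>\<^sub>M count_space UNIV)"
    by (intro measurable_pair_finite_label) simp_all
  show "\<exists>B. \<forall>x\<in>space M. \<forall>c. \<bar>L (f x) c\<bar> \<le> B"
    using assms(1) predictor_in_simplex[OF assms(2)] unfolding bounded_measurable_loss_def by metis
qed

text \<open>Fubini against the density of \<open>P\<close>: integrating out the label over counting
  measure gives the finite sum in \<open>inner_risk\<close>. The disintegration is a parameter, so
  that several predictors and losses can be compared through one and the same pair \<mu>,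
  \<eta>.\<close>

lemma risk_eq_integral_inner_risk:
  fixes P :: "('x \<times> 'c::finite) measure"
  assumes P: "joint_distribution M P"
    and \<mu>: "prob_space \<mu>" "sets \<mu> = sets M" and \<eta>: "\<eta> \<in> predictors M"
    and dens: "P = density (\<mu> \<Otimes>\<^sub>M count_space UNIV) (\<lambda>(x, c). ennreal (\<eta> x $ c))"
    and L: "bounded_measurable_loss L" and f: "f \<in> predictors M"
  shows "integrable P (\<lambda>(x, y). L (f x) y)"
    and "risk L P f = ereal (\<integral>x. inner_risk L (\<eta> x) (f x) \<partial>\<mu>)"
    and "integrable \<mu> (\<lambda>x. inner_risk L (\<eta> x) (f x))"
proof -
  interpret P: prob_space P using P by (simp add: joint_distribution_def)
  interpret \<mu>: prob_space \<mu> by fact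
  interpret C: sigma_finite_measure "count_space (UNIV :: 'c set)"
    by (simp add: sigma_finite_measure_count_space_finite)
  interpret pair_sigma_finite \<mu> "count_space (UNIV :: 'c set)" ..
  let ?N = "\<mu> \<Otimes>\<^sub>M count_space (UNIV :: 'c set)"
  have sP: "sets P = sets (M \<Otimes>\<^sub>M count_space UNIV)"
    using P by (simp add: joint_distribution_def)
  have sN: "sets ?N = sets (M \<Otimes>\<^sub>M count_space UNIV)"
    using \<mu>(2) by (rule sets_pair_measure_cong) simp
  have space\<mu>: "space \<mu> = space M" using \<mu>(2) by (rule sets_eq_imp_space_eq)
  note Lm = bounded_loss_along_predictor[OF L f]
  obtain B where B: "\<And>x c. x \<in> space M \<Longrightarrow> \<bar>L (f x) c\<bar> \<le> B" using Lm(2) by blast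
  have LP: "(\<lambda>(x, y). L (f x) y) \<in> borel_measurable P"
    using Lm(1) by (simp cong: measurable_cong_sets add: sP)
  have LN: "(\<lambda>(x, y). L (f x) y) \<in> borel_measurable ?N"
    using Lm(1) by (simp cong: measurable_cong_sets add: sN)
  have "(\<lambda>x. \<eta> x $ c) \<in> borel_measurable \<mu>" for c
    using predictor_component_measurable[OF \<eta>] by (simp cong: measurable_cong_sets add: \<mu>(2))
  then have \<eta>N: "(\<lambda>(x, c). \<eta> x $ c) \<in> borel_measurable ?N"
    by (intro measurable_pair_finite_label) simp_all
  show int: "integrable P (\<lambda>(x, y). L (f x) y)"
    using LP B by (intro P.integrable_const_bound[where B=B]) (auto simp: space_joint[OF P] intro!: AE_I2)
  have \<eta>0: "AE z in ?N. 0 \<le> (\<lambda>(x, c). \<eta> x $ c) z"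
    using \<eta> by (intro AE_I2) (auto simp: space_pair_measure space\<mu> prob_simplex_nonneg predictor_in_simplex)
  have dens': "P = density ?N (\<lambda>z. ennreal ((\<lambda>(x, c). \<eta> x $ c) z))"
    by (subst dens) (simp add: case_prod_beta')
  have intN: "integrable ?N (\<lambda>z. (\<lambda>(x, c). \<eta> x $ c) z *\<^sub>R (\<lambda>(x, y). L (f x) y) z)"
    using int integrable_density[OF LN \<eta>N \<eta>0] by (simp add: dens'[symmetric])
  have inner: "(\<integral>c. (\<lambda>(x, c). \<eta> x $ c) (x, c) *\<^sub>R (\<lambda>(x, y). L (f x) y) (x, c) \<partial>count_space UNIV)
      = inner_risk L (\<eta> x) (f x)" for x
    by (simp add: lebesgue_integral_count_space_finite inner_risk_def)
  show "integrable \<mu> (\<lambda>x. inner_risk L (\<eta> x) (f x))"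
    using integrable_fst'[OF intN] unfolding inner .
  have "integral\<^sup>L P (\<lambda>(x, y). L (f x) y) = (\<integral>z. (\<lambda>(x, c). \<eta> x $ c) z *\<^sub>R (\<lambda>(x, y). L (f x) y) z \<partial>?N)"
    using integral_density[OF LN \<eta>N \<eta>0] by (simp add: dens'[symmetric])
  also have "\<dots> = (\<integral>x. inner_risk L (\<eta> x) (f x) \<partial>\<mu>)"
    using integral_fst'[OF intN] unfolding inner by simp
  finally show "risk L P f = ereal (\<integral>x. inner_risk L (\<eta> x) (f x) \<partial>\<mu>)"
    unfolding risk_def ext_expectation_integrable[OF int] by simp
qed

section \<open>Moving the label noise from the distribution into the loss\<close>

text \<open>The expected loss over the noisy label when the true label is \<open>i\<close>; as a
  vector in \<open>i\<close> it is the transpose of \<open>T\<close> applied to the losses at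
  \<open>q\<close>.\<close>

definition noise_averaged_loss :: "real ^ 'c ^ 'c \<Rightarrow> 'c::finite loss \<Rightarrow> 'c loss" where
  "noise_averaged_loss T L q i = (\<Sum>j\<in>UNIV. T $ j $ i * L q j)"

text \<open>The transpose of \<open>T\<close> acting on the loss is adjoint to \<open>T\<close>
  acting on the label distribution. Through this identity the noisy conditional distribution
  \<open>T *v \<eta> x\<close> appears without disintegrating the noisy law.\<close>

lemma inner_risk_noise_averaged:
  "inner_risk (noise_averaged_loss T L) p q = inner_risk L (T *v p) q"
  unfolding inner_risk_def noise_averaged_loss_def matrix_vector_mult_def
  by (simp add: sum_distrib_left sum_distrib_right) (subst sum.swap, simp add: ac_simps)

lemma bounded_measurable_noise_averaged:
  assumes "bounded_measurable_loss L"
  shows "bounded_measurable_loss (noise_averaged_loss T L)"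
  unfolding bounded_measurable_loss_def
proof safe
  have [measurable]: "(\<lambda>q. L q j) \<in> borel_measurable (restrict_space borel prob_simplex)" for j
    using assms by (simp add: bounded_measurable_loss_def)
  show "(\<lambda>q. noise_averaged_loss T L q c) \<in> borel_measurable (restrict_space borel prob_simplex)" for c
    unfolding noise_averaged_loss_def by measurable
  obtain B where B: "\<And>q c. q \<in> prob_simplex \<Longrightarrow> \<bar>L q c\<bar> \<le> B"
    using assms unfolding bounded_measurable_loss_def by blast
  have "\<bar>noise_averaged_loss T L q c\<bar> \<le> (\<Sum>i\<in>UNIV. \<Sum>j\<in>UNIV. \<bar>T $ j $ i\<bar> * B)"
    if q: "q \<in> prob_simplex" for q c
  proof -
    have B0: "0 \<le> B" using B[OF q, of undefined] by linarith
    have "\<bar>noise_averaged_loss T L q c\<bar> \<le> (\<Sum>j\<in>UNIV. \<bar>T $ j $ c\<bar> * B)"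
      unfolding noise_averaged_loss_def using B[OF q]
      by (intro order_trans[OF sum_abs] sum_mono) (auto simp: abs_mult intro: mult_left_mono)
    also have "\<dots> \<le> (\<Sum>i\<in>UNIV. \<Sum>j\<in>UNIV. \<bar>T $ j $ i\<bar> * B)"
      using B0 by (intro member_le_sum[where f="\<lambda>i. \<Sum>j\<in>UNIV. \<bar>T $ j $ i\<bar> * B"]) (auto intro!: sum_nonneg)
    finally show ?thesis .
  qed
  then show "\<exists>B. \<forall>q\<in>prob_simplex. \<forall>c. \<bar>noise_averaged_loss T L q c\<bar> \<le> B" by blast
qed

text \<open>The noisy law is unwound in three moves: change of variables for the push-forward,
  passage to the density given by the entries of \<open>T\<close>, and Fubini in the noisy
  label.\<close>

lemma noisy_risk_eq:
  fixes T :: "real ^ 'c ^ 'c::finite"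
  assumes P: "joint_distribution M P" and T: "column_stochastic T"
    and L: "bounded_measurable_loss L" and f: "f \<in> predictors M"
  shows "risk L (noisy_distribution T P) f = risk (noise_averaged_loss T L) P f"
proof -
  interpret P: prob_space P using P by (simp add: joint_distribution_def)
  interpret C: sigma_finite_measure "count_space (UNIV :: 'c set)"
    by (simp add: sigma_finite_measure_count_space_finite)
  interpret C: finite_measure "count_space (UNIV :: 'c set)"
    by (simp add: finite_measure_count_space)
  interpret pair_sigma_finite P "count_space (UNIV :: 'c set)" ..
  let ?N = "P \<Otimes>\<^sub>M count_space (UNIV :: 'c set)"
  interpret N: finite_measure ?N by (intro finite_measure_pair_measure) unfold_locales
  have sP [measurable_cong]: "sets P = sets (M \<Otimes>\<^sub>M count_space UNIV)"
    using P by (simp add: joint_distribution_def)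
  note Lm [measurable] = bounded_loss_along_predictor(1)[OF L f]
  obtain B where B: "\<And>x c. x \<in> space M \<Longrightarrow> \<bar>L (f x) c\<bar> \<le> B"
    using bounded_loss_along_predictor(2)[OF L f] by blast
  let ?t = "\<lambda>((x, i), j). T $ j $ i" and ?g = "\<lambda>((x, i), j). L (f x) j"
    and ?\<pi> = "\<lambda>((x, i), j). (x, j) :: 'a \<times> 'c"
  have "(\<lambda>(x, i). T $ j $ i) \<in> borel_measurable P" for j
  proof -
    have "(\<lambda>z. T $ j $ snd z) \<in> borel_measurable P"
      by (rule measurable_compose[where N="count_space UNIV"]) measurable
    then show ?thesis by (simp add: case_prod_beta')
  qed
  then have "(\<lambda>(z, j). (\<lambda>(x, i). T $ j $ i) z) \<in> borel_measurable ?N"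
    by (rule measurable_pair_finite_label)
  then have tN: "?t \<in> borel_measurable ?N"
    by (simp add: case_prod_beta')
  have "fst \<in> P \<rightarrow>\<^sub>M M" by measurable
  then have "(\<lambda>z. (fst (fst z), snd z)) \<in> ?N \<rightarrow>\<^sub>M M \<Otimes>\<^sub>M count_space UNIV"
    by (intro measurable_Pair measurable_snd) (rule measurable_compose[OF measurable_fst])
  then have \<pi>N: "?\<pi> \<in> ?N \<rightarrow>\<^sub>M P"
    by (simp add: case_prod_beta' measurable_cong_sets[OF refl sP])
  have "(\<lambda>z. (\<lambda>(x, c). L (f x) c) (?\<pi> z)) \<in> borel_measurable ?N"
    using \<pi>N by (rule measurable_compose) measurable
  then have gN: "?g \<in> borel_measurable ?N" by (simp add: case_prod_beta')
  \<comment> \<open>Nonnegative entries with column sums 1 lie in the unit interval, so the bound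
    \<open>B\<close> on the loss also bounds the weighted loss. Boundedness suffices for
    integrability because \<open>?N\<close> is a finite measure.\<close>
  have t0: "0 \<le> ?t z" and t1: "?t z \<le> 1" for z :: "('a \<times> 'c) \<times> 'c"
    using T member_le_sum[of "snd z" UNIV "\<lambda>j. T $ j $ snd (fst z)"]
    by (auto simp: column_stochastic_def case_prod_beta')
  have noisy: "noisy_joint T P = density ?N (\<lambda>z. ennreal (?t z))"
    unfolding noisy_joint_def by (simp add: case_prod_beta')
  have \<pi>J: "?\<pi> \<in> noisy_joint T P \<rightarrow>\<^sub>M P" using \<pi>N by (simp add: noisy)
  have LP: "(\<lambda>(x, y). L (f x) y) \<in> borel_measurable P" by measurable
  have intN: "integrable ?N (\<lambda>z. ?t z *\<^sub>R ?g z)"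
  proof (rule N.integrable_const_bound[where B=B])
    show "AE z in ?N. norm (?t z *\<^sub>R ?g z) \<le> B"
    proof (rule AE_I2)
      fix z assume z: "z \<in> space ?N"
      have "\<bar>?t z\<bar> * \<bar>?g z\<bar> \<le> 1 * B"
        using z t0[of z] t1[of z] B[of "fst (fst z)" "snd z"]
        by (intro mult_mono) (auto simp: space_pair_measure space_joint[OF P] case_prod_beta')
      then show "norm (?t z *\<^sub>R ?g z) \<le> B" by (simp add: abs_mult)
    qed
    show "(\<lambda>z. ?t z *\<^sub>R ?g z) \<in> borel_measurable ?N" using tN gN by simp
  qed
  have g\<pi>: "(\<lambda>z. (\<lambda>(x, y). L (f x) y) (?\<pi> z)) = ?g" by auto
  have AE_t0: "AE z in ?N. 0 \<le> ?t z" using t0 by (rule AE_I2)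
  have "integrable (noisy_joint T P) ?g"
    using intN integrable_density[OF gN tN AE_t0] by (simp add: noisy)
  then have intD: "integrable (noisy_distribution T P) (\<lambda>(x, y). L (f x) y)"
    using integrable_distr_eq[OF \<pi>J LP] unfolding g\<pi> noisy_distribution_def by simp
  have "integral\<^sup>L (noisy_distribution T P) (\<lambda>(x, y). L (f x) y) = integral\<^sup>L (noisy_joint T P) ?g"
    using integral_distr[OF \<pi>J LP] unfolding g\<pi> noisy_distribution_def .
  also have "\<dots> = integral\<^sup>L ?N (\<lambda>z. ?t z *\<^sub>R ?g z)"
    using integral_density[OF gN tN AE_t0] by (simp add: noisy)
  also have "\<dots> = (\<integral>y. \<integral>j. ?t (y, j) *\<^sub>R ?g (y, j) \<partial>count_space UNIV \<partial>P)"
    by (rule integral_fst'[OF intN, symmetric])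
  also have "\<dots> = (\<integral>(x, y). noise_averaged_loss T L (f x) y \<partial>P)"
    by (simp add: lebesgue_integral_count_space_finite noise_averaged_loss_def case_prod_beta')
  finally have eq: "integral\<^sup>L (noisy_distribution T P) (\<lambda>(x, y). L (f x) y) =
      (\<integral>(x, y). noise_averaged_loss T L (f x) y \<partial>P)" .
  \<comment> \<open>The disintegration serves here to supply integrability of the averaged loss
    under \<open>P\<close>.\<close>
  obtain \<mu> \<eta> where "prob_space \<mu>" "sets \<mu> = sets M" "\<eta> \<in> predictors M"
    "P = density (\<mu> \<Otimes>\<^sub>M count_space UNIV) (\<lambda>(x, c). ennreal (\<eta> x $ c))"
    using joint_disintegration[OF P] .
  note intA = risk_eq_integral_inner_risk(1)[OF P this bounded_measurable_noise_averaged[OF L] f]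
  show ?thesis
    unfolding risk_def ext_expectation_integrable[OF intD] ext_expectation_integrable[OF intA] eq ..
qed

section \<open>Compactness of the simplex and continuity of the forward loss\<close>

lemma closed_prob_simplex: "closed (prob_simplex :: (real ^ 'c::finite) set)"
proof -
  have "prob_simplex = (\<Inter>i. {p :: real ^ 'c. 0 \<le> p $ i}) \<inter> {p. (\<Sum>i\<in>UNIV. p $ i) = 1}"
    by (auto simp: prob_simplex_def)
  also have "closed \<dots>"
    by (intro closed_Int closed_INT ballI closed_Collect_le closed_Collect_eq continuous_intros)
  finally show ?thesis .
qed

lemma compact_prob_simplex: "compact (prob_simplex :: (real ^ 'c::finite) set)"
proof -
  have "norm p \<le> 1" if "p \<in> prob_simplex" for p :: "real ^ 'c"
    using norm_le_l1_cart[of p] that by (simp add: prob_simplex_def)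
  then have "bounded (prob_simplex :: (real ^ 'c) set)" by (auto simp: bounded_iff)
  then show ?thesis using closed_prob_simplex by (simp add: compact_eq_bounded_closed)
qed

lemma column_stochastic_simplex:
  fixes T :: "real ^ 'c ^ 'c::finite"
  assumes T: "column_stochastic T" and p: "p \<in> prob_simplex"
  shows "T *v p \<in> prob_simplex"
proof -
  have "(\<Sum>i\<in>UNIV. \<Sum>j\<in>UNIV. T $ i $ j * p $ j) = (\<Sum>j\<in>UNIV. (\<Sum>i\<in>UNIV. T $ i $ j) * p $ j)"
    by (subst sum.swap) (simp add: sum_distrib_right)
  then show ?thesis
    using T p by (auto simp: column_stochastic_def prob_simplex_def matrix_vector_mult_def intro!: sum_nonneg)
qed

lemma bounded_measurable_continuous_loss:
  assumes "continuous_loss l" shows "bounded_measurable_loss l"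
  unfolding bounded_measurable_loss_def
proof safe
  show "(\<lambda>q. l q c) \<in> borel_measurable (restrict_space borel prob_simplex)" for c
    using assms by (intro borel_measurable_continuous_on_restrict) (simp add: continuous_loss_def)
  have "\<exists>B. \<forall>q\<in>prob_simplex. \<bar>l q c\<bar> \<le> B" for c
  proof -
    have "bounded ((\<lambda>q. l q c) ` prob_simplex)"
      using assms compact_prob_simplex
      by (intro compact_imp_bounded compact_continuous_image) (auto simp: continuous_loss_def)
    then show ?thesis by (auto simp: bounded_iff)
  qed
  then obtain B where B: "\<And>q c. q \<in> prob_simplex \<Longrightarrow> \<bar>l q c\<bar> \<le> B c" by metis
  have "\<bar>l q c\<bar> \<le> Max (range B)" if "q \<in> prob_simplex" for q c
    using B[OF that, of c] by (rule order_trans) (intro Max_ge, auto)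
  then show "\<exists>B. \<forall>q\<in>prob_simplex. \<forall>c. \<bar>l q c\<bar> \<le> B" by blast
qed

lemma continuous_forward_loss:
  assumes "continuous_loss l" "column_stochastic T" shows "continuous_loss (forward_loss T l)"
  unfolding continuous_loss_def forward_loss_def
proof
  fix c
  have Tc: "continuous_on prob_simplex (\<lambda>q. T *v q)"
    by (intro linear_continuous_on matrix_vector_mul_bounded_linear)
  have lc: "continuous_on prob_simplex (\<lambda>q. l q c)"
    using assms(1) by (simp add: continuous_loss_def)
  show "continuous_on prob_simplex (\<lambda>q. l (T *v q) c)"
    by (rule continuous_on_compose2[OF lc Tc]) (auto simp: column_stochastic_simplex[OF assms(2)])
qed

section \<open>The 0-1 loss\<close>

abbreviation top_label :: "real ^ 'c::{finite,linorder} \<Rightarrow> 'c" where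
  "top_label q \<equiv> Min {j. \<forall>k. q $ k \<le> q $ j}"

lemma top_label_is_maximal: "q $ k \<le> q $ top_label q"
proof -
  have "Max (range (($) q)) \<in> range (($) q)" by (intro Max_in) auto
  then obtain j where "q $ j = Max (range (($) q))" by (auto simp: image_iff)
  then have "j \<in> {j. \<forall>k. q $ k \<le> q $ j}" by auto
  then have "top_label q \<in> {j. \<forall>k. q $ k \<le> q $ j}" by (intro Min_in) auto
  then show ?thesis by auto
qed

text \<open>Replaces \<open>Min\<close> of a set by finitely many comparisons of coordinates, from
  which measurability of the 0-1 loss can be read off.\<close>

lemma top_label_eq_iff:
  "c = top_label q \<longleftrightarrow> (\<forall>k. q $ k \<le> q $ c) \<and> (\<forall>j. j < c \<longrightarrow> (\<exists>k. q $ j < q $ k))"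
proof
  assume c: "c = top_label q"
  have "c \<le> j" if "\<forall>k. q $ k \<le> q $ j" for j
    unfolding c using that by (intro Min_le) auto
  then show "(\<forall>k. q $ k \<le> q $ c) \<and> (\<forall>j. j < c \<longrightarrow> (\<exists>k. q $ j < q $ k))"
    using top_label_is_maximal[of q] c by (metis not_le)
next
  assume c: "(\<forall>k. q $ k \<le> q $ c) \<and> (\<forall>j. j < c \<longrightarrow> (\<exists>k. q $ j < q $ k))"
  show "c = top_label q"
    by (rule Min_eqI[symmetric]) (use c in \<open>auto simp flip: not_le\<close>)
qed

lemma bounded_measurable_zero_one: "bounded_measurable_loss (zero_one_loss :: 'c::{finite,linorder} loss)"
  unfolding bounded_measurable_loss_def
proof safe
  fix c :: "'c::{finite,linorder}"
  have [measurable]: "(\<lambda>v :: real ^ 'c::{finite,linorder}. v $ i) \<in> borel_measurable borel" for i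
    by (intro borel_measurable_continuous_onI continuous_intros)
  have "(\<lambda>q :: real ^ 'c::{finite,linorder}. zero_one_loss q c) \<in> borel_measurable borel"
    unfolding zero_one_loss_def top_label_eq_iff by measurable
  then show "(\<lambda>q. zero_one_loss q c) \<in> borel_measurable (restrict_space borel prob_simplex)"
    by (rule measurable_restrict_space1)
  show "\<exists>B. \<forall>q\<in>prob_simplex. \<forall>c :: 'c::{finite,linorder}. \<bar>zero_one_loss q c\<bar> \<le> B"
    by (rule exI[of _ 1]) (auto simp: zero_one_loss_def)
qed

lemma inner_risk_zero_one:
  assumes "p \<in> prob_simplex"
  shows "inner_risk zero_one_loss p q = 1 - p $ top_label q"
proof -
  have "inner_risk zero_one_loss p q = (\<Sum>c\<in>UNIV. p $ c - (if c = top_label q then p $ c else 0))"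
    unfolding inner_risk_def zero_one_loss_def by (intro sum.cong) auto
  also have "\<dots> = 1 - p $ top_label q"
    using assms by (simp add: sum_subtractf prob_simplex_def)
  finally show ?thesis .
qed

text \<open>With \<open>h = top_label q\<close>, the gap is the sum of \<open>p $ k - q $ k\<close>,
  \<open>q $ k - q $ h\<close> and \<open>q $ h - p $ h\<close>. The middle term is at most 0 and
  each outer one is at most the norm, whence the factor 2.\<close>

lemma component_gap_le: "p $ k - p $ top_label q \<le> 2 * norm (p - q)"
  for p :: "real ^ 'c::{finite,linorder}"
  using top_label_is_maximal[of q k] component_le_norm_cart[of "p - q" k]
    component_le_norm_cart[of "p - q" "top_label q"] by (auto simp: abs_le_iff)

section \<open>A uniform lower bound for the surrogate regret\<close>

text \<open>For a proper loss, column-stochastic \<open>T\<close> and \<open>p\<close> in the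
  simplex, the subtracted term is the minimal inner risk at \<open>T *v p\<close>. Since
  \<open>T *v p\<close> is itself a value of \<open>T\<close> on the simplex, this is the pointwise
  excess of the forward loss under noise.\<close>

definition surrogate_regret :: "'c::finite loss \<Rightarrow> real ^ 'c ^ 'c \<Rightarrow> real ^ 'c \<Rightarrow> real ^ 'c \<Rightarrow> real" where
  "surrogate_regret l T p q = inner_risk l (T *v p) (T *v q) - inner_risk l (T *v p) (T *v p)"

lemma surrogate_regret_nonneg:
  assumes "proper_loss l" "column_stochastic T" "p \<in> prob_simplex" "q \<in> prob_simplex"
  shows "0 \<le> surrogate_regret l T p q"
proof -
  have "ereal (inner_risk l (T *v p) (T *v p)) \<le> ereal (inner_risk l (T *v p) (T *v q))"
    using assms column_stochastic_simplex unfolding proper_loss_def min_inner_risk_def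
    by (metis INF_lower)
  then show ?thesis by (simp add: surrogate_regret_def)
qed

text \<open>Injectivity of \<open>T\<close> keeps distinct arguments distinct, and strict properness
  excludes a second minimizer at \<open>T *v p\<close>.\<close>

lemma surrogate_regret_pos:
  assumes l: "strictly_proper_loss l" and T: "column_stochastic T" "invertible T"
    and pq: "p \<in> prob_simplex" "q \<in> prob_simplex" "p \<noteq> q"
  shows "0 < surrogate_regret l T p q"
proof -
  have pr: "proper_loss l" using l by (simp add: strictly_proper_loss_def)
  note Tpq = column_stochastic_simplex[OF T(1) pq(1)] column_stochastic_simplex[OF T(1) pq(2)]
  have "T *v q \<noteq> T *v p"
    using inj_matrix_vector_mult[OF T(2)] pq(3) by (auto dest: injD)
  then have "ereal (inner_risk l (T *v p) (T *v q)) \<noteq> ereal (inner_risk l (T *v p) (T *v p))"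
    using l Tpq unfolding strictly_proper_loss_def proper_loss_def by metis
  then show ?thesis
    using surrogate_regret_nonneg[OF pr T(1) pq(1,2)] by (auto simp: surrogate_regret_def)
qed

text \<open>A continuous positive function on a compact set of pairs attains a positive
  minimum.\<close>

lemma surrogate_regret_gap:
  fixes l :: "'c::finite loss"
  assumes c: "continuous_loss l" and l: "strictly_proper_loss l"
    and T: "column_stochastic T" "invertible T" and "0 < d"
  shows "\<exists>m>0. m \<le> 1 \<and> (\<forall>p\<in>prob_simplex. \<forall>q\<in>prob_simplex.
            d \<le> norm (p - q) \<longrightarrow> m \<le> surrogate_regret l T p q)"
proof (cases "\<exists>p\<in>prob_simplex. \<exists>q\<in>prob_simplex. d \<le> norm (p - q :: real ^ 'c)")
  \<comment> \<open>For \<open>d\<close> beyond the diameter of the simplex there are no such pairs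
    and any constant in the unit interval will do.\<close>
  case False
  then have "\<forall>p\<in>prob_simplex. \<forall>q\<in>prob_simplex. d \<le> norm (p - q) \<longrightarrow> 1 \<le> surrogate_regret l T p q"
    by blast
  then show ?thesis by (intro exI[of _ 1]) simp
next
  case True
  define K where "K = (prob_simplex \<times> prob_simplex) \<inter> {z :: (real ^ 'c) \<times> (real ^ 'c). d \<le> norm (fst z - snd z)}"
  have "compact K" unfolding K_def
    by (intro compact_Int_closed compact_Times compact_prob_simplex closed_Collect_le continuous_intros)
  moreover have "K \<noteq> {}" using True by (auto simp: K_def)
  moreover have "continuous_on K (\<lambda>z. surrogate_regret l T (fst z) (snd z))"
  proof -
    have Tc: "continuous_on K (\<lambda>z. T *v fst z)" "continuous_on K (\<lambda>z. T *v snd z)"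
      by (rule bounded_linear.continuous_on[OF matrix_vector_mul_bounded_linear]; intro continuous_intros)+
    have lc: "continuous_on prob_simplex (\<lambda>q. l q i)" for i
      using c by (simp add: continuous_loss_def)
    have lT_fst: "continuous_on K (\<lambda>z. l (T *v fst z) i)" for i
      by (rule continuous_on_compose2[OF lc Tc(1)]) (auto simp: K_def column_stochastic_simplex[OF T(1)])
    have lT_snd: "continuous_on K (\<lambda>z. l (T *v snd z) i)" for i
      by (rule continuous_on_compose2[OF lc Tc(2)]) (auto simp: K_def column_stochastic_simplex[OF T(1)])
    show ?thesis
      unfolding surrogate_regret_def inner_risk_def
      by (intro continuous_on_diff continuous_on_sum continuous_on_mult continuous_on_component
          lT_fst lT_snd Tc)
  qed
  ultimately obtain z where z: "z \<in> K"
    and min: "\<And>w. w \<in> K \<Longrightarrow> surrogate_regret l T (fst z) (snd z) \<le> surrogate_regret l T (fst w) (snd w)"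
    using continuous_attains_inf[of K "\<lambda>z. surrogate_regret l T (fst z) (snd z)"] by blast
  have "0 < surrogate_regret l T (fst z) (snd z)"
    using z \<open>0 < d\<close> by (intro surrogate_regret_pos[OF l T]) (auto simp: K_def)
  moreover have "surrogate_regret l T (fst z) (snd z) \<le> surrogate_regret l T p q"
    if "p \<in> prob_simplex" "q \<in> prob_simplex" "d \<le> norm (p - q)" for p q
    using min[of "(p, q)"] that by (simp add: K_def)
  ultimately show ?thesis
    \<comment> \<open>Capping at 1 later makes every ramp 1-Lipschitz and their supremum
      finite.\<close>
    by (intro exI[of _ "min 1 (surrogate_regret l T (fst z) (snd z))"]) (auto intro: min.coboundedI2)
qed

section \<open>The calibration function as a supremum of ramps\<close>

text \<open>Strict monotonicity: \<open>g\<close> is convex with \<open>g 0 = 0\<close>, so \<open>g r \<le> (r / s) * g s\<close> for \<open>r < s\<close>.\<close>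

lemma ramp_sup_calibration:
  fixes m :: "real \<Rightarrow> real"
  assumes m_unit: "\<forall>\<epsilon>>0. 0 < m \<epsilon> \<and> m \<epsilon> \<le> 1"
  defines "g \<equiv> \<lambda>r. SUP \<epsilon>\<in>{0<..1}. m \<epsilon> * max 0 (r - \<epsilon>)"
  shows "continuous_on {0..1} g" "strict_mono_on {0..1} g" "g 0 = 0" "\<And>r. 0 \<le> g r"
    and "\<And>r K. 0 \<le> K \<Longrightarrow> (\<And>\<epsilon>. 0 < \<epsilon> \<Longrightarrow> m \<epsilon> * (r - \<epsilon>) \<le> K) \<Longrightarrow> g r \<le> K"
proof -
  have m: "0 < m \<epsilon>" "m \<epsilon> \<le> 1" if "0 < \<epsilon>" for \<epsilon> using m_unit that by auto
  have ramp_le: "m \<epsilon> * max 0 (r - \<epsilon>) \<le> max 0 r" if "0 < \<epsilon>" for \<epsilon> r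
    using mult_mono[of "m \<epsilon>" 1 "max 0 (r - \<epsilon>)" "max 0 r"] m[OF that] that by auto
  have bdd: "bdd_above ((\<lambda>\<epsilon>. m \<epsilon> * max 0 (r - \<epsilon>)) ` {0<..1})" for r
    using ramp_le by (intro bdd_aboveI2[where M="max 0 r"]) auto
  have upper: "m \<epsilon> * max 0 (r - \<epsilon>) \<le> g r" if "0 < \<epsilon>" "\<epsilon> \<le> 1" for \<epsilon> r
    unfolding g_def using that by (intro cSUP_upper[OF _ bdd]) auto
  have least: "g r \<le> K" if "\<And>\<epsilon>. 0 < \<epsilon> \<Longrightarrow> \<epsilon> \<le> 1 \<Longrightarrow> m \<epsilon> * max 0 (r - \<epsilon>) \<le> K" for r K
    unfolding g_def using that by (intro cSUP_least) auto
  show g0: "0 \<le> g r" for r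
    using upper[of 1 r] m[of 1] by (intro order_trans[OF _ upper[of 1 r]]) (auto simp: less_imp_le)
  show "g 0 = 0"
    by (intro antisym g0 least) auto
  \<comment> \<open>Because \<open>K\<close> is nonnegative, the bound on the affine function passes
    to its truncation at 0.\<close>
  show "g r \<le> K" if "0 \<le> K" "\<And>\<epsilon>. 0 < \<epsilon> \<Longrightarrow> m \<epsilon> * (r - \<epsilon>) \<le> K" for r K
    using that by (intro least) (auto simp: max_def)
  \<comment> \<open>Slopes \<open>m \<epsilon> \<le> 1\<close> make each ramp 1-Lipschitz, and a
    supremum of such functions is again 1-Lipschitz.\<close>
  have lip: "g s \<le> g r + \<bar>s - r\<bar>" for r s
  proof (rule least)
    fix \<epsilon> :: real assume \<epsilon>: "0 < \<epsilon>" "\<epsilon> \<le> 1"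
    have "m \<epsilon> * max 0 (s - \<epsilon>) \<le> m \<epsilon> * (max 0 (r - \<epsilon>) + \<bar>s - r\<bar>)"
      using m(1)[OF \<epsilon>(1)] by (intro mult_left_mono) auto
    also have "\<dots> \<le> m \<epsilon> * max 0 (r - \<epsilon>) + \<bar>s - r\<bar>"
      using m(2)[OF \<epsilon>(1)] by (simp add: distrib_left mult_left_le_one_le m(1)[OF \<epsilon>(1), THEN less_imp_le])
    also have "\<dots> \<le> g r + \<bar>s - r\<bar>" using upper[OF \<epsilon>] by simp
    finally show "m \<epsilon> * max 0 (s - \<epsilon>) \<le> g r + \<bar>s - r\<bar>" .
  qed
  have "1-lipschitz_on {0..1} g"
  proof (rule lipschitz_onI)
    show "dist (g x) (g y) \<le> 1 * dist x y" for x y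
      using lip[of x y] lip[of y x] by (auto simp: dist_real_def)
  qed simp
  then show "continuous_on {0..1} g" by (rule lipschitz_on_continuous_on)
  show "strict_mono_on {0..1} g"
  proof (rule strict_mono_onI)
    fix r s :: real assume r: "r \<in> {0..1}" and s: "s \<in> {0..1}" and "r < s"
    then have s0: "0 < s" by auto
    \<comment> \<open>The ramp starting at \<open>s/2\<close> is already positive at
      \<open>s\<close>.\<close>
    have "0 < m (s/2) * max 0 (s - s/2)" using m(1)[of "s/2"] s0 by auto
    also have "\<dots> \<le> g s" using s s0 by (intro upper) auto
    finally have gs: "0 < g s" .
    have "g r \<le> (r / s) * g s"
    proof (rule least)
      fix \<epsilon> :: real assume \<epsilon>: "0 < \<epsilon>" "\<epsilon> \<le> 1"
      \<comment> \<open>This is \<open>r - \<epsilon> \<le> (r / s) * (s - \<epsilon>)\<close> with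
        denominators cleared.\<close>
      have "r * \<epsilon> \<le> s * \<epsilon>" using \<open>r < s\<close> \<epsilon> by (intro mult_right_mono) auto
      then have "max 0 (r - \<epsilon>) \<le> (r / s) * max 0 (s - \<epsilon>)"
        using s0 r by (cases "\<epsilon> \<le> r") (auto simp: max_def field_simps intro: mult_left_mono)
      then have "m \<epsilon> * max 0 (r - \<epsilon>) \<le> m \<epsilon> * ((r / s) * max 0 (s - \<epsilon>))"
        using m(1)[OF \<epsilon>(1)] by (intro mult_left_mono) auto
      also have "\<dots> = (r / s) * (m \<epsilon> * max 0 (s - \<epsilon>))" by simp
      also have "\<dots> \<le> (r / s) * g s" using upper[OF \<epsilon>] r s0 by (intro mult_left_mono) auto
      finally show "m \<epsilon> * max 0 (r - \<epsilon>) \<le> (r / s) * g s" .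
    qed
    also have "\<dots> < 1 * g s" using \<open>r < s\<close> s0 gs by (intro mult_strict_right_mono) auto
    finally show "g r < g s" by simp
  qed
qed

section \<open>Integrating the pointwise comparison\<close>

text \<open>Real numbers \<open>r\<close> and \<open>K\<close> confine the extended arithmetic to
  this proof. They are fixed before \<epsilon> and \<open>m\<close> are quantified, so one pair
  obeys all the affine bounds at once, and any choice of gap constants made from \<open>l\<close>
  and \<open>T\<close> alone can be inserted.\<close>

lemma regret_comparison:
  fixes l :: "'c::{finite,linorder} loss"
  assumes c: "continuous_loss l" and l: "proper_loss l" and T: "column_stochastic T"
    and P: "joint_distribution M P" and f: "f \<in> predictors M"
  obtains r K where "risk zero_one_loss P f - bayes_risk M zero_one_loss P = ereal r"
    "0 \<le> K"
    "ereal K \<le> risk (forward_loss T l) (noisy_distribution T P) f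
       - bayes_risk M (forward_loss T l) (noisy_distribution T P)"
    "\<forall>\<epsilon> m. 0 < \<epsilon> \<longrightarrow> 0 < m \<longrightarrow> (\<forall>p\<in>prob_simplex. \<forall>q\<in>prob_simplex.
        \<epsilon> / 2 \<le> norm (p - q) \<longrightarrow> m \<le> surrogate_regret l T p q) \<longrightarrow> m * (r - \<epsilon>) \<le> K"
proof -
  obtain \<mu> \<eta> where \<mu>: "prob_space \<mu>" "sets \<mu> = sets M" and \<eta>: "\<eta> \<in> predictors M"
    and dens: "P = density (\<mu> \<Otimes>\<^sub>M count_space UNIV) (\<lambda>(x, c). ennreal (\<eta> x $ c))"
    using joint_disintegration[OF P] .
  interpret \<mu>: prob_space \<mu> by fact
  have space\<mu>: "space \<mu> = space M" using \<mu>(2) by (rule sets_eq_imp_space_eq)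
  note simplex = predictor_in_simplex[OF \<eta>]
  note f_simplex = predictor_in_simplex[OF f]
  let ?L = "zero_one_loss :: 'c loss" and ?F = "forward_loss T l"
  note clean = risk_eq_integral_inner_risk[OF P \<mu> \<eta> dens bounded_measurable_zero_one]
  note F = bounded_measurable_continuous_loss[OF continuous_forward_loss[OF c T]]
  \<comment> \<open>The noisy risk becomes an integral over the clean marginal of inner risks at
    \<open>T *v \<eta> x\<close>.\<close>
  note noisy = risk_eq_integral_inner_risk[OF P \<mu> \<eta> dens bounded_measurable_noise_averaged[OF F, of T],
      unfolded inner_risk_noise_averaged]
  note noisy = noisy(3) trans[OF noisy_risk_eq[OF P T F] noisy(2)]
  define R where "R h = (\<integral>x. inner_risk ?L (\<eta> x) (h x) \<partial>\<mu>)" for h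
  define K where "K = (\<integral>x. surrogate_regret l T (\<eta> x) (f x) \<partial>\<mu>)"
  have fwd: "inner_risk ?F (T *v p) q = inner_risk l (T *v p) (T *v q)" for p q
    by (simp add: inner_risk_def forward_loss_def)
  have int_K: "integrable \<mu> (\<lambda>x. surrogate_regret l T (\<eta> x) (f x))"
    using noisy(1)[OF f] noisy(1)[OF \<eta>] unfolding surrogate_regret_def fwd[symmetric]
    by (rule Bochner_Integration.integrable_diff)
  have K0: "0 \<le> K" unfolding K_def
    by (intro integral_nonneg_AE AE_I2 surrogate_regret_nonneg[OF l T]) (auto simp: space\<mu> simplex f_simplex)
  have "ereal K = risk ?F (noisy_distribution T P) f - risk ?F (noisy_distribution T P) \<eta>"
    using noisy(1)[OF f] noisy(2)[OF f f] noisy(1)[OF \<eta>] noisy(2)[OF \<eta> \<eta>]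
    by (simp add: K_def surrogate_regret_def fwd[symmetric])
  also have "\<dots> \<le> risk ?F (noisy_distribution T P) f - bayes_risk M ?F (noisy_distribution T P)"
    unfolding bayes_risk_def by (intro ereal_minus_mono INF_lower \<eta> order_refl)
  finally have K_le: "ereal K \<le> risk ?F (noisy_distribution T P) f - bayes_risk M ?F (noisy_distribution T P)" .
  have R_nonneg: "0 \<le> R h" if h: "h \<in> predictors M" for h
    unfolding R_def
    by (intro integral_nonneg_AE AE_I2)
      (simp add: space\<mu> simplex inner_risk_zero_one prob_simplex_component_le_1)
  have bayes: "bayes_risk M ?L P = (INF h\<in>predictors M. ereal (R h))"
    unfolding bayes_risk_def R_def using clean(2) by (intro INF_cong) auto
  have b_le: "bayes_risk M ?L P \<le> ereal (R f)" unfolding bayes by (rule INF_lower[OF f])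
  have b_ge: "0 \<le> bayes_risk M ?L P" unfolding bayes using R_nonneg by (intro INF_greatest) auto
  \<comment> \<open>The clean Bayes risk lies between 0 and \<open>R f\<close>, hence is a real
    number.\<close>
  obtain b where b: "bayes_risk M ?L P = ereal b" using b_le b_ge by (cases "bayes_risk M ?L P") auto
  have rf: "risk ?L P f = ereal (R f)" using clean(2)[OF f] by (simp add: R_def)
  have calibrated: "m * (R f - b - \<epsilon>) \<le> K" if \<epsilon>: "0 < \<epsilon>" and m: "0 < m"
    and gap: "\<forall>p\<in>prob_simplex. \<forall>q\<in>prob_simplex. \<epsilon> / 2 \<le> norm (p - q) \<longrightarrow> m \<le> surrogate_regret l T p q"
    for \<epsilon> m
  proof -
    \<comment> \<open>Solved for \<open>R h\<close>, so that the infimum over all competitors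
      \<open>h\<close> can be taken on one side.\<close>
    have "R f - \<epsilon> - K / m \<le> R h" if h: "h \<in> predictors M" for h
    proof -
      have pointwise: "m * (inner_risk ?L (\<eta> x) (f x) - inner_risk ?L (\<eta> x) (h x) - \<epsilon>)
          \<le> surrogate_regret l T (\<eta> x) (f x)" if "x \<in> space \<mu>" for x
      proof -
        have \<eta>x: "\<eta> x \<in> prob_simplex" and fx: "f x \<in> prob_simplex"
          using that by (auto simp: space\<mu> simplex f_simplex)
        define \<delta> where "\<delta> = \<eta> x $ top_label (h x) - \<eta> x $ top_label (f x)"
        have eq: "inner_risk ?L (\<eta> x) (f x) - inner_risk ?L (\<eta> x) (h x) = \<delta>"
          using \<eta>x by (simp add: inner_risk_zero_one \<delta>_def)
        show ?thesis
        \<comment> \<open>For small \<delta> the left side is at most 0 and the regret is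
          nonnegative. Otherwise \<epsilon> < \<delta> is at most twice the distance of
          \<open>\<eta> x\<close> and \<open>f x\<close>, so the gap at distance \<epsilon>/2
          applies, and \<open>\<delta> - \<epsilon> \<le> 1\<close>.\<close>
        proof (cases "\<delta> \<le> \<epsilon>")
          case True
          then have "m * (\<delta> - \<epsilon>) \<le> 0" using m by (simp add: mult_le_0_iff)
          then show ?thesis unfolding eq using surrogate_regret_nonneg[OF l T \<eta>x fx] by linarith
        next
          case False
          have "\<delta> \<le> 1" unfolding \<delta>_def
            using prob_simplex_component_le_1[OF \<eta>x] prob_simplex_nonneg[OF \<eta>x]
            by (smt (verit))
          then have "m * (\<delta> - \<epsilon>) \<le> m" using m \<epsilon> by simp
          also have "m \<le> surrogate_regret l T (\<eta> x) (f x)"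
            using False component_gap_le[of "\<eta> x" "top_label (h x)" "f x"]
            by (intro gap[rule_format] \<eta>x fx) (simp add: \<delta>_def)
          finally show ?thesis unfolding eq .
        qed
      qed
      have "m * (R f - R h - \<epsilon>) = (\<integral>x. m * (inner_risk ?L (\<eta> x) (f x) - inner_risk ?L (\<eta> x) (h x) - \<epsilon>) \<partial>\<mu>)"
        unfolding R_def using clean(3)[OF f] clean(3)[OF h] by (simp add: \<mu>.prob_space)
      also have "\<dots> \<le> K" unfolding K_def
        using clean(3)[OF f] clean(3)[OF h] int_K pointwise by (intro integral_mono) auto
      finally show ?thesis using m by (simp add: field_simps)
    qed
    then have "ereal (R f - \<epsilon> - K / m) \<le> bayes_risk M ?L P"
      unfolding bayes by (intro INF_greatest) auto
    then show ?thesis using m unfolding b by (simp add: field_simps)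
  qed
  have "risk ?L P f - bayes_risk M ?L P = ereal (R f - b)" by (simp add: b rf)
  with K0 K_le show thesis using calibrated by (intro that) auto
qed

section \<open>Assembling the calibration function\<close>

theorem theorem5:
  fixes l :: "'c::{finite,linorder} loss" and T :: "real ^ 'c::{finite,linorder} ^ 'c::{finite,linorder}"
  assumes "continuous_loss l" and "strictly_proper_loss l"
    and "column_stochastic T" and "invertible T"
  shows "\<exists>\<theta> :: ereal \<Rightarrow> ereal.
           \<theta> \<in> {0..1} \<rightarrow> {0..\<infinity>} \<and> strict_mono_on {0..1} \<theta> \<and> continuous_on {0..1} \<theta> \<and> \<theta> 0 = 0 \<and>
           (\<forall>(M :: 'x measure) P f.
              joint_distribution M P \<longrightarrow>
              bayes_risk M (forward_loss T l) (noisy_distribution T P) < \<infinity> \<longrightarrow>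
              f \<in> predictors M \<longrightarrow>
              \<theta> (risk zero_one_loss P f - bayes_risk M zero_one_loss P)
                \<le> risk (forward_loss T l) (noisy_distribution T P) f
                  - bayes_risk M (forward_loss T l) (noisy_distribution T P))"
proof -
  \<comment> \<open>The gap constants are chosen before any \<open>M\<close>, \<open>P\<close> or
    \<open>f\<close> is introduced; this is why \<theta> depends only on \<open>l\<close> and
    \<open>T\<close>.\<close>
  have "\<exists>m. 0 < \<epsilon> \<longrightarrow> 0 < m \<and> m \<le> 1 \<and> (\<forall>p\<in>prob_simplex. \<forall>q\<in>prob_simplex.
      \<epsilon> / 2 \<le> norm (p - q) \<longrightarrow> m \<le> surrogate_regret l T p q)" for \<epsilon> :: real
    using surrogate_regret_gap[OF assms, of "\<epsilon> / 2"] by auto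
  then obtain m where m: "\<forall>\<epsilon>>0. 0 < m \<epsilon> \<and> m \<epsilon> \<le> 1"
    and gap: "\<And>\<epsilon>. 0 < \<epsilon> \<Longrightarrow> \<forall>p\<in>prob_simplex. \<forall>q\<in>prob_simplex.
      \<epsilon> / 2 \<le> norm (p - q) \<longrightarrow> m \<epsilon> \<le> surrogate_regret l T p q" by metis
  define g where "g r = (SUP \<epsilon>\<in>{0<..1}. m \<epsilon> * max 0 (r - \<epsilon>))" for r :: real
  note g = ramp_sup_calibration[OF m, folded g_def]
  define \<theta> where "\<theta> e = ereal (g (real_of_ereal e))" for e
  have unit: "\<exists>r. e = ereal r \<and> r \<in> {0..1}" if "e \<in> {0..1}" for e :: ereal
    using that by (cases e) auto
  have "\<theta> \<in> {0..1} \<rightarrow> {0..\<infinity>}" using g(4) by (auto simp: \<theta>_def)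
  moreover have "strict_mono_on {0..1} \<theta>"
  proof (rule strict_mono_onI)
    fix a b :: ereal assume ab: "a \<in> {0..1}" "b \<in> {0..1}" "a < b"
    obtain r s where "a = ereal r" "b = ereal s" "r \<in> {0..1}" "s \<in> {0..1}"
      using unit ab by meson
    with ab(3) show "\<theta> a < \<theta> b"
      using strict_mono_onD[OF g(2), of r s] by (simp add: \<theta>_def)
  qed
  moreover have "continuous_on {0..1} \<theta>"
  proof -
    \<comment> \<open>The conversion to reals is continuous away from the two infinities, which the
      unit interval avoids.\<close>
    have "continuous_on {0..1} real_of_ereal"
      by (rule continuous_on_subset[OF continuous_on_real]) auto
    moreover have "real_of_ereal ` {0..1} \<subseteq> {0..1}" by (auto dest!: unit)
    ultimately have "continuous_on {0..1} (\<lambda>e. g (real_of_ereal e))"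
      using g(1) by (rule continuous_on_compose2[rotated 1])
    then show ?thesis unfolding \<theta>_def by (rule continuous_on_ereal)
  qed
  moreover have "\<theta> 0 = 0" using g(3) by (simp add: \<theta>_def zero_ereal_def)
  moreover have "\<theta> (risk zero_one_loss P f - bayes_risk M zero_one_loss P)
      \<le> risk (forward_loss T l) (noisy_distribution T P) f
        - bayes_risk M (forward_loss T l) (noisy_distribution T P)"
    if P: "joint_distribution M P" and f: "f \<in> predictors M" for M :: "'x measure" and P f
  proof -
    have "proper_loss l" using assms(2) by (simp add: strictly_proper_loss_def)
    from regret_comparison[OF assms(1) this assms(3) P f] obtain r K
      where r: "risk zero_one_loss P f - bayes_risk M zero_one_loss P = ereal r"
      and K: "0 \<le> K" "ereal K \<le> risk (forward_loss T l) (noisy_distribution T P) f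
         - bayes_risk M (forward_loss T l) (noisy_distribution T P)"
      and ineq: "\<forall>\<epsilon> m. 0 < \<epsilon> \<longrightarrow> 0 < m \<longrightarrow> (\<forall>p\<in>prob_simplex. \<forall>q\<in>prob_simplex.
        \<epsilon> / 2 \<le> norm (p - q) \<longrightarrow> m \<le> surrogate_regret l T p q) \<longrightarrow> m * (r - \<epsilon>) \<le> K" .
    \<comment> \<open>Each ramp in the supremum is bounded by \<open>K\<close> at \<open>r\<close>,
      by the affine bound for its own \<epsilon> and \<open>m \<epsilon>\<close>.\<close>
    have "g r \<le> K"
      by (rule g(5)[OF K(1)]) (use ineq m gap in blast)
    then have "\<theta> (ereal r) \<le> ereal K" by (simp add: \<theta>_def)
    also note K(2)
    finally show ?thesis unfolding r .
  qed
  ultimately show ?thesis by blast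
qed

end
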